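(* Let $k,d\in\mathbb{N}$ and $m^{(d)}=(m_1,\ldots,m_d)\in\mathbb{N}^d$. Let $a_d$ (resp. $b_d$) denote the total number of descents (resp. levels) of all $m^{(d)}$-tensor words over $[k]$, i.e., $a_d=\sum_{w\in T(m^{(d)},k)}\mathrm{des}(w)$ and $b_d=\sum_{w\in T(m^{(d)},k)}\mathrm{lev}(w)$. Then $$a_d=\frac{1}{2}\left(d\prod_{\ell\in[d]}m_{\ell}-\sum_{i\in[d]}\prod_{\ell\in[d],\,\ell\neq i}m_{\ell}\right)(k-1)k^{\prod_{\ell\in[d]}m_{\ell}-1}$$ and $b_d=2a_d/(k-1)$, i.e., $$b_d=\left(d\prod_{\ell\in[d]}m_{\ell}-\sum_{i\in[d]}\prod_{\ell\in[d],\,\ell\neq i}m_{\ell}\right)k^{\prod_{\ell\in[d]}m_{\ell}-1}.$$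
   Context: $\mathbb{N}$ is the set of natural numbers $\{1,2,\ldots\}$ and $[n]=\{1,\ldots,n\}$. An empty product equals $1$. For $m^{(d)}=(m_1,\ldots,m_d)\in\mathbb{N}^d$, an $m^{(d)}$-tensor word over $[k]$ is a function $w\colon[m_1]\times\cdots\times[m_d]\to[k]$; $T(m^{(d)},k)$ denotes the set of all of them. With $e_\ell$ the $\ell$th standard basis vector of $\mathbb{R}^d$, a descent (resp. level) of $w$ is a pair $(i,j)\in([m_1]\times\cdots\times[m_d])^2$ such that $w(i)>w(j)$ (resp. $w(i)=w(j)$) and $j=i+e_\ell$ for some $\ell\in[d]$. $\mathrm{des}(w)$ (resp. $\mathrm{lev}(w)$) denotes the number of descents (resp. levels) of $w$. *)

theory Defs
  imports Complex_Main "HOL-Library.FuncSet"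
begin

text \<open>A tuple \<open>(m\<^sub>1, \<dots>, m\<^sub>d)\<close> is a function on \<open>nat\<close> of which only the values on \<open>{1..d}\<close>
  matter. Positions and words are extensional functions, so that each of them has exactly one
  representative and the sets below are finite of the expected cardinality.\<close>

definition positions :: "nat \<Rightarrow> (nat \<Rightarrow> nat) \<Rightarrow> (nat \<Rightarrow> nat) set" where
  "positions d m = (\<Pi>\<^sub>E l\<in>{1..d}. {1..m l})"

definition tensor_words :: "nat \<Rightarrow> (nat \<Rightarrow> nat) \<Rightarrow> nat \<Rightarrow> ((nat \<Rightarrow> nat) \<Rightarrow> nat) set" where
  "tensor_words d m k = positions d m \<rightarrow>\<^sub>E {1..k}"

definition std_basis :: "nat \<Rightarrow> nat \<Rightarrow> nat" where
  "std_basis l q = (if q = l then 1 else 0)"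

definition adjacent :: "nat \<Rightarrow> (nat \<Rightarrow> nat) \<Rightarrow> (nat \<Rightarrow> nat) \<Rightarrow> bool" where
  "adjacent d i j \<longleftrightarrow> (\<exists>l\<in>{1..d}. \<forall>q\<in>{1..d}. j q = i q + std_basis l q)"

definition descents ::
  "nat \<Rightarrow> (nat \<Rightarrow> nat) \<Rightarrow> ((nat \<Rightarrow> nat) \<Rightarrow> nat) \<Rightarrow> ((nat \<Rightarrow> nat) \<times> (nat \<Rightarrow> nat)) set" where
  "descents d m w =
     {(i, j). i \<in> positions d m \<and> j \<in> positions d m \<and> w i > w j \<and> adjacent d i j}"

definition levels ::
  "nat \<Rightarrow> (nat \<Rightarrow> nat) \<Rightarrow> ((nat \<Rightarrow> nat) \<Rightarrow> nat) \<Rightarrow> ((nat \<Rightarrow> nat) \<times> (nat \<Rightarrow> nat)) set" where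
  "levels d m w =
     {(i, j). i \<in> positions d m \<and> j \<in> positions d m \<and> w i = w j \<and> adjacent d i j}"

definition des :: "nat \<Rightarrow> (nat \<Rightarrow> nat) \<Rightarrow> ((nat \<Rightarrow> nat) \<Rightarrow> nat) \<Rightarrow> nat" where
  "des d m w = card (descents d m w)"

definition lev :: "nat \<Rightarrow> (nat \<Rightarrow> nat) \<Rightarrow> ((nat \<Rightarrow> nat) \<Rightarrow> nat) \<Rightarrow> nat" where
  "lev d m w = card (levels d m w)"

definition total_des :: "nat \<Rightarrow> (nat \<Rightarrow> nat) \<Rightarrow> nat \<Rightarrow> nat" where
  "total_des d m k = (\<Sum>w\<in>tensor_words d m k. des d m w)"

definition total_lev :: "nat \<Rightarrow> (nat \<Rightarrow> nat) \<Rightarrow> nat \<Rightarrow> nat" where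
  "total_lev d m k = (\<Sum>w\<in>tensor_words d m k. lev d m w)"

end

theory Submission
  imports Defs
begin

text \<open>
  The totals are computed by counting in two ways. Both descents and levels are neighbouring pairs of
  positions whose letters satisfy a fixed relation \<open>R\<close>. Summing over all words first, one sees
  that every neighbouring pair contributes the same amount, because the letters at two distinct
  positions vary freely and independently of the rest of the word: if \<open>r\<close> pairs of letters are
  related by \<open>R\<close> and there are \<open>N\<close> positions, a pair of positions is hit by
  \<open>r * k ^ (N - 2)\<close> words (\<open>sum_card_related_pairs\<close>). It remains to insert two
  numbers. There are \<open>k\<close> pairs of equal letters and \<open>k * (k - 1) / 2\<close> strictly decreasing
  ones. In direction \<open>l\<close> a neighbouring pair is determined by its first position, which
  is arbitrary except that its \<open>l\<close>-th coordinate must not be maximal; hence there are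
  \<open>(m l - 1) * (\<Prod>q\<noteq>l. m q)\<close> such pairs, and summation over \<open>l\<close> yields the
  bracket in the formulas (\<open>card_adjacent_pairs\<close>).
\<close>

section \<open>Neighbouring positions in the grid\<close>

definition adjacent_pairs :: "nat \<Rightarrow> (nat \<Rightarrow> nat) \<Rightarrow> ((nat \<Rightarrow> nat) \<times> (nat \<Rightarrow> nat)) set" where
  "adjacent_pairs d m = {(i, j). i \<in> positions d m \<and> j \<in> positions d m \<and> adjacent d i j}"

lemma finite_positions: "finite (positions d m)"
  by (simp add: positions_def finite_PiE)

lemma card_positions: "card (positions d m) = (\<Prod>l\<in>{1..d}. m l)"
  by (simp add: positions_def card_PiE)

lemma finite_adjacent_pairs: "finite (adjacent_pairs d m)"
  by (rule finite_subset[of _ "positions d m \<times> positions d m"])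
     (auto simp: adjacent_pairs_def finite_positions)

lemma adjacent_pairs_neq: "(i, j) \<in> adjacent_pairs d m \<Longrightarrow> i \<noteq> j"
  by (force simp: adjacent_pairs_def adjacent_def std_basis_def)

section \<open>Counting words by the letters at two positions\<close>

text \<open>Prescribing two values shrinks two factors of the function space to singletons, so the
  functions with prescribed values again form a product.\<close>

lemma card_PiE_two_values:
  assumes "finite P" and "i \<in> P" "j \<in> P" "i \<noteq> j" and "a \<in> C" "b \<in> C"
  shows "card {w \<in> P \<rightarrow>\<^sub>E C. w i = a \<and> w j = b} = card C ^ (card P - 2)"
proof -
  let ?T = "\<lambda>x. if x = i then {a} else if x = j then {b} else C"
  have "{w \<in> P \<rightarrow>\<^sub>E C. w i = a \<and> w j = b} = PiE P ?T"
    using assms by (auto simp: PiE_iff extensional_def split: if_splits)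
  moreover have "card (PiE P ?T) = (\<Prod>x\<in>P. card (?T x))"
    using assms(1) by (rule card_PiE)
  moreover have "(\<Prod>x\<in>P. card (?T x)) = (\<Prod>x\<in>P - {i, j}. card C)"
    using assms by (intro prod.mono_neutral_cong_right) auto
  moreover have "card (P - {i, j}) = card P - 2"
    using assms by (subst card_Diff_subset) auto
  ultimately show ?thesis by simp
qed

lemma card_PiE_related:
  assumes "finite P" "finite C" and "i \<in> P" "j \<in> P" "i \<noteq> j"
  shows "card {w \<in> P \<rightarrow>\<^sub>E C. R (w i) (w j)} =
    card {(a, b). a \<in> C \<and> b \<in> C \<and> R a b} * card C ^ (card P - 2)"
proof -
  let ?L = "{(a, b). a \<in> C \<and> b \<in> C \<and> R a b}"
  let ?W = "\<lambda>(a, b). {w \<in> P \<rightarrow>\<^sub>E C. w i = a \<and> w j = b}"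
  have finL: "finite ?L"
    by (rule finite_subset[of _ "C \<times> C"]) (use assms in auto)
  have "finite (P \<rightarrow>\<^sub>E C)" using assms by (simp add: finite_PiE)
  then have finW: "finite (?W p)" for p by (cases p) simp
  have "{w \<in> P \<rightarrow>\<^sub>E C. R (w i) (w j)} = (\<Union>p\<in>?L. ?W p)"
    using assms by auto
  also have "card \<dots> = (\<Sum>p\<in>?L. card (?W p))"
    using finL finW by (intro card_UN_disjoint) auto
  also have "\<dots> = (\<Sum>p\<in>?L. card C ^ (card P - 2))"
    using assms by (intro sum.cong) (auto simp: card_PiE_two_values)
  finally show ?thesis by simp
qed

text \<open>Exchanging the summations over words and over pairs of positions is the double count; since
  the words are functions on \<open>P\<close>, it holds for any set \<open>E\<close> of pairs of distinct points,
  not only for neighbours in a grid.\<close>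

lemma sum_card_related_pairs:
  assumes "finite P" "finite C" "finite E"
    and E: "\<And>i j. (i, j) \<in> E \<Longrightarrow> i \<in> P \<and> j \<in> P \<and> i \<noteq> j"
  shows "(\<Sum>w\<in>P \<rightarrow>\<^sub>E C. card {(i, j) \<in> E. R (w i) (w j)}) =
    card E * (card {(a, b). a \<in> C \<and> b \<in> C \<and> R a b} * card C ^ (card P - 2))"
proof -
  let ?r = "\<lambda>w e. R (w (fst e)) (w (snd e))"
  have fin: "finite (P \<rightarrow>\<^sub>E C)" using assms by (simp add: finite_PiE)
  have "(\<Sum>w\<in>P \<rightarrow>\<^sub>E C. card {(i, j) \<in> E. R (w i) (w j)}) = (\<Sum>w\<in>P \<rightarrow>\<^sub>E C. card {e \<in> E. ?r w e})"
    by (intro sum.cong arg_cong[of _ _ card]) auto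
  also have "\<dots> = (\<Sum>e\<in>E. card {w \<in> P \<rightarrow>\<^sub>E C. ?r w e})"
    using sum.swap_restrict[OF fin \<open>finite E\<close>, of "\<lambda>_ _. 1::nat" ?r] by simp
  also have "\<dots> = (\<Sum>e\<in>E. card {(a, b). a \<in> C \<and> b \<in> C \<and> R a b} * card C ^ (card P - 2))"
    using assms by (intro sum.cong) (auto intro!: card_PiE_related dest: E)
  finally show ?thesis by simp
qed

section \<open>The number of neighbouring pairs\<close>

text \<open>A neighbouring pair in direction \<open>l\<close> is recorded by its first entry, whose
  \<open>l\<close>-th coordinate stays below \<open>m l\<close>. Moving in different directions gives different
  pairs, so the counts add up.\<close>

lemma card_adjacent_pairs:
  "card (adjacent_pairs d m) = (\<Sum>l\<in>{1..d}. (m l - 1) * (\<Prod>q\<in>{1..d} - {l}. m q))"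
proof -
  let ?T = "\<lambda>l q. {1..(if q = l then m l - 1 else m q)}"
  let ?F = "\<lambda>l. PiE {1..d} (?T l)"
  let ?g = "\<lambda>l i. (i, i(l := Suc (i l)))"
  have eq: "adjacent_pairs d m = (\<Union>l\<in>{1..d}. ?g l ` ?F l)"
  proof (intro equalityI subsetI)
    fix e assume "e \<in> adjacent_pairs d m"
    then obtain i j l where e: "e = (i, j)" and i: "i \<in> positions d m" and j: "j \<in> positions d m"
      and l: "l \<in> {1..d}" and jq: "\<And>q. q \<in> {1..d} \<Longrightarrow> j q = i q + std_basis l q"
      by (auto simp: adjacent_pairs_def adjacent_def)
    have "j = i(l := Suc (i l))"
    proof
      fix q
      show "j q = (i(l := Suc (i l))) q"
        using i j l jq[of q]
        by (cases "q \<in> {1..d}")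
           (auto simp: positions_def std_basis_def PiE_def extensional_def)
    qed
    moreover have "Suc (i l) \<le> m l"
      using PiE_mem[OF j[unfolded positions_def] l] jq[OF l] by (simp add: std_basis_def)
    then have "i \<in> ?F l" using i l by (auto simp: positions_def PiE_iff)
    ultimately show "e \<in> (\<Union>l\<in>{1..d}. ?g l ` ?F l)" using e l by blast
  next
    fix e assume "e \<in> (\<Union>l\<in>{1..d}. ?g l ` ?F l)"
    then obtain l i where l: "l \<in> {1..d}" and i: "i \<in> ?F l" and e: "e = ?g l i" by blast
    have iq: "1 \<le> i q \<and> i q \<le> (if q = l then m l - 1 else m q)" if "q \<in> {1..d}" for q
      using PiE_mem[OF i that] by simp
    have ext: "i \<in> extensional {1..d}" using i by (simp add: PiE_def)
    have "i \<in> positions d m"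
      using iq ext by (force simp: positions_def PiE_def split: if_splits)
    moreover have "Suc (i l) \<le> m l" using iq[OF l] by simp linarith
    then have "i(l := Suc (i l)) \<in> positions d m"
      using l \<open>i \<in> positions d m\<close>
      by (auto simp: positions_def PiE_iff extensional_def)
    moreover have "adjacent d i (i(l := Suc (i l)))"
      unfolding adjacent_def using l by (intro bexI[of _ l]) (auto simp: std_basis_def)
    ultimately show "e \<in> adjacent_pairs d m" using e by (simp add: adjacent_pairs_def)
  qed
  have disj: "?g l ` ?F l \<inter> ?g l' ` ?F l' = {}" if "l \<noteq> l'" for l l'
  proof -
    have "i(l := Suc (i l)) \<noteq> i(l' := Suc (i l'))" for i :: "nat \<Rightarrow> nat"
      using that by (metis fun_upd_other fun_upd_same n_not_Suc_n)
    then show ?thesis by auto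
  qed
  have "card (adjacent_pairs d m) = (\<Sum>l\<in>{1..d}. card (?g l ` ?F l))"
    unfolding eq using disj by (intro card_UN_disjoint) (auto intro!: finite_imageI finite_PiE)
  also have "\<dots> = (\<Sum>l\<in>{1..d}. \<Prod>q\<in>{1..d}. if q = l then m l - 1 else m q)"
  proof (intro sum.cong refl)
    fix l
    have "inj_on (?g l) (?F l)" by (auto intro: inj_onI)
    then show "card (?g l ` ?F l) = (\<Prod>q\<in>{1..d}. if q = l then m l - 1 else m q)"
      by (simp add: card_image card_PiE)
  qed
  also have "\<dots> = (\<Sum>l\<in>{1..d}. (m l - 1) * (\<Prod>q\<in>{1..d} - {l}. m q))"
  proof (intro sum.cong refl)
    fix l assume "l \<in> {1..d}"
    then have "(\<Prod>q\<in>{1..d}. if q = l then m l - 1 else m q) =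
        (m l - 1) * (\<Prod>q\<in>{1..d} - {l}. if q = l then m l - 1 else m q)"
      by (subst prod.remove[of _ l]) simp_all
    also have "(\<Prod>q\<in>{1..d} - {l}. if q = l then m l - 1 else m q) = (\<Prod>q\<in>{1..d} - {l}. m q)"
      by (intro prod.cong) auto
    finally show "(\<Prod>q\<in>{1..d}. if q = l then m l - 1 else m q) =
        (m l - 1) * (\<Prod>q\<in>{1..d} - {l}. m q)" .
  qed
  finally show ?thesis .
qed

lemma real_card_adjacent_pairs:
  assumes "\<And>l. l \<in> {1..d} \<Longrightarrow> m l \<ge> 1"
  shows "real (card (adjacent_pairs d m)) =
    real d * (\<Prod>l\<in>{1..d}. real (m l)) - (\<Sum>i\<in>{1..d}. \<Prod>l\<in>{1..d} - {i}. real (m l))"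
proof -
  let ?p = "\<Prod>l\<in>{1..d}. real (m l)"
  have "real ((m l - 1) * (\<Prod>q\<in>{1..d} - {l}. m q)) = ?p - (\<Prod>q\<in>{1..d} - {l}. real (m q))"
    if "l \<in> {1..d}" for l
  proof -
    have "?p = real (m l) * (\<Prod>q\<in>{1..d} - {l}. real (m q))"
      using that by (intro prod.remove) auto
    then show ?thesis
      using assms[OF that] by (simp add: of_nat_diff algebra_simps)
  qed
  then have "real (card (adjacent_pairs d m)) =
      (\<Sum>l\<in>{1..d}. ?p - (\<Prod>q\<in>{1..d} - {l}. real (m q)))"
    unfolding card_adjacent_pairs of_nat_sum by (intro sum.cong) auto
  then show ?thesis by (simp add: sum_subtractf)
qed

section \<open>Pairs of letters\<close>

lemma card_equal_letters: "card {(a, b). a \<in> {1..k} \<and> b \<in> {1..k} \<and> a = b} = (k::nat)"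
proof -
  have "{(a, b). a \<in> {1..k} \<and> b \<in> {1..k} \<and> a = b} = (\<lambda>a. (a, a)) ` {1..k}" by auto
  then show ?thesis by (simp add: card_image inj_on_def)
qed

text \<open>Swapping the entries matches the decreasing pairs with the increasing ones, and the two kinds
  together are all pairs off the diagonal.\<close>

lemma card_decreasing_letters:
  "2 * card {(a, b). a \<in> {1..k} \<and> b \<in> {1..k} \<and> b < a} = k * (k - 1 :: nat)"
proof -
  let ?D = "{(a, b). a \<in> {1..k} \<and> b \<in> {1..k} \<and> b < a}"
  let ?I = "{(a, b). a \<in> {1..k} \<and> b \<in> {1..k} \<and> a < b}"
  let ?Q = "{(a, b). a \<in> {1..k} \<and> b \<in> {1..k} \<and> a = b}"
  have fin: "finite ?D" "finite ?I" "finite ?Q"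
    by (rule finite_subset[of _ "{1..k} \<times> {1..k}"]; auto)+
  have "?I = prod.swap ` ?D" by (auto simp: image_iff)
  then have "card ?I = card ?D" by (simp add: card_image)
  moreover have "card (?D \<union> ?I) = card ?D + card ?I"
    using fin by (intro card_Un_disjoint) auto
  moreover have "card (?D \<union> ?I \<union> ?Q) = card (?D \<union> ?I) + card ?Q"
    using fin by (intro card_Un_disjoint) auto
  moreover have "?D \<union> ?I \<union> ?Q = {1..k} \<times> {1..k}" by auto
  moreover have "card ({1..k} \<times> {1..k}) = k * k" by simp
  ultimately have "2 * card ?D + k = k * k" using card_equal_letters[of k] by simp
  then show ?thesis by (simp add: diff_mult_distrib2)
qed

section \<open>Totals over all words\<close>

lemma total_related:
  "(\<Sum>w\<in>tensor_words d m k. card {(i, j) \<in> adjacent_pairs d m. R (w i) (w j)}) =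
    card (adjacent_pairs d m) *
      (card {(a, b). a \<in> {1..k} \<and> b \<in> {1..k} \<and> R a b} * k ^ ((\<Prod>l\<in>{1..d}. m l) - 2))"
proof -
  have "i \<in> positions d m \<and> j \<in> positions d m \<and> i \<noteq> j" if "(i, j) \<in> adjacent_pairs d m" for i j
    using adjacent_pairs_neq[OF that] that by (simp add: adjacent_pairs_def)
  from sum_card_related_pairs[OF finite_positions _ finite_adjacent_pairs this,
      where C = "{1..k}" and R = R]
  show ?thesis by (simp add: tensor_words_def card_positions)
qed

text \<open>Fewer than two positions admit no neighbouring pair, so the truncated subtraction in the exponent is harmless:
  whenever it would matter, the number of neighbouring pairs is \<open>0\<close>.\<close>

lemma card_adjacent_pairs_mult_power:
  "card (adjacent_pairs d m) * (k * k ^ ((\<Prod>l\<in>{1..d}. m l) - 2)) =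
    card (adjacent_pairs d m) * k ^ ((\<Prod>l\<in>{1..d}. m l) - 1)"
proof (cases "adjacent_pairs d m = {}")
  case False
  then obtain i j where ij: "(i, j) \<in> adjacent_pairs d m" by auto
  have "{i, j} \<subseteq> positions d m" using ij by (simp add: adjacent_pairs_def)
  then have "card {i, j} \<le> card (positions d m)" by (rule card_mono[OF finite_positions])
  then have "2 \<le> (\<Prod>l\<in>{1..d}. m l)"
    using adjacent_pairs_neq[OF ij] by (simp add: card_positions)
  then have "(\<Prod>l\<in>{1..d}. m l) - 1 = Suc ((\<Prod>l\<in>{1..d}. m l) - 2)" by simp
  then show ?thesis by (simp only: power_Suc)
qed simp

lemma total_lev_eq:
  "total_lev d m k = card (adjacent_pairs d m) * k ^ ((\<Prod>l\<in>{1..d}. m l) - 1)"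
proof -
  have "levels d m w = {(i, j) \<in> adjacent_pairs d m. w i = w j}" for w
    by (auto simp: levels_def adjacent_pairs_def)
  then show ?thesis
    unfolding total_lev_def lev_def
    by (simp only: total_related card_equal_letters card_adjacent_pairs_mult_power)
qed

lemma total_des_eq:
  "2 * total_des d m k = card (adjacent_pairs d m) * (k - 1) * k ^ ((\<Prod>l\<in>{1..d}. m l) - 1)"
proof -
  let ?c = "card (adjacent_pairs d m)" and ?N = "\<Prod>l\<in>{1..d}. m l"
  let ?r = "card {(a, b). a \<in> {1..k} \<and> b \<in> {1..k} \<and> b < a}"
  have "descents d m w = {(i, j) \<in> adjacent_pairs d m. w j < w i}" for w
    by (auto simp: descents_def adjacent_pairs_def)
  then have "total_des d m k = ?c * (?r * k ^ (?N - 2))"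
    unfolding total_des_def des_def
    by (simp only: total_related[where R = "\<lambda>a b. b < a"])
  then have "2 * total_des d m k = ?c * ((2 * ?r) * k ^ (?N - 2))" by simp
  also have "\<dots> = (k - 1) * (?c * (k * k ^ (?N - 2)))"
    unfolding card_decreasing_letters by (simp only: mult.assoc mult.commute mult.left_commute)
  also have "\<dots> = (k - 1) * (?c * k ^ (?N - 1))" by (simp only: card_adjacent_pairs_mult_power)
  finally show ?thesis by (simp only: mult.assoc mult.commute mult.left_commute)
qed

theorem mainTheorem2:
  fixes k d :: nat and m :: "nat \<Rightarrow> nat"
  assumes "k \<ge> 1" and "d \<ge> 1" and "\<And>l. l \<in> {1..d} \<Longrightarrow> m l \<ge> 1"
  shows "real (total_des d m k) =
           1 / 2 * (real d * (\<Prod>l\<in>{1..d}. real (m l))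
                    - (\<Sum>i\<in>{1..d}. \<Prod>l\<in>{1..d} - {i}. real (m l)))
             * (real k - 1) * real k ^ ((\<Prod>l\<in>{1..d}. m l) - 1) \<and>
         (k \<noteq> 1 \<longrightarrow> real (total_lev d m k) = 2 * real (total_des d m k) / (real k - 1)) \<and>
         real (total_lev d m k) =
           (real d * (\<Prod>l\<in>{1..d}. real (m l))
            - (\<Sum>i\<in>{1..d}. \<Prod>l\<in>{1..d} - {i}. real (m l)))
             * real k ^ ((\<Prod>l\<in>{1..d}. m l) - 1)"
proof -
  let ?c = "real d * (\<Prod>l\<in>{1..d}. real (m l)) - (\<Sum>i\<in>{1..d}. \<Prod>l\<in>{1..d} - {i}. real (m l))"
  let ?K = "real k ^ ((\<Prod>l\<in>{1..d}. m l) - 1)"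
  have c: "real (card (adjacent_pairs d m)) = ?c"
    using assms(3) by (rule real_card_adjacent_pairs)
  have lev: "real (total_lev d m k) = ?c * ?K"
    by (simp only: total_lev_eq of_nat_mult of_nat_power c)
  have "2 * real (total_des d m k) = real (2 * total_des d m k)" by simp
  also have "\<dots> = ?c * (real k - 1) * ?K"
    using \<open>k \<ge> 1\<close> by (simp only: total_des_eq of_nat_mult of_nat_power c of_nat_diff of_nat_1)
  finally have des: "2 * real (total_des d m k) = ?c * (real k - 1) * ?K" .
  have "real (total_des d m k) = 1 / 2 * ?c * (real k - 1) * ?K" using des by argo
  moreover have "real (total_lev d m k) = 2 * real (total_des d m k) / (real k - 1)" if "k \<noteq> 1"
    unfolding des lev using that by simp
  ultimately show ?thesis using lev by blast
qed

end
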